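(* Suppose a 4-regular multigraph $F$ has three pairwise compatible Euler systems $C$, $C'$ and $C''$ (that is, no two of $C,C',C''$ involve the same transition at any vertex). Then $$\mathcal{I}_{C}(C')\cdot\mathcal{I}_{C''}(C)\cdot\mathcal{I}_{C'}(C'')$$ is the identity matrix (over $GF(2)$).
   Context: Multigraphs are finite; in a 4-regular multigraph every vertex has degree 4, and loops and parallel edges are allowed (a loop contributes 2 to the degree of its vertex). Each edge consists of two half-edges, so exactly four half-edges are incident at each vertex. A transition at a vertex $v$ is one of the three ways to sort the four half-edges at $v$ into two disjoint pairs. A circuit is a closed walk with no repeated edge; circuits are considered without preferred starting point or orientation. Choosing one transition at each vertex of $F$ yields a partition of the edge set $E(F)$ into edge-disjoint circuits (consecutive half-edges of a circuit passing through a vertex are those paired by the chosen transition); such a partition, together with its transitions, is a circuit partition $P$ of $F$, and $P$ is said to involve the chosen transition at each vertex. An Euler system is a circuit partition containing exactly one circuit (an Euler circuit, containing every edge of the component) for each connected component of $F$. Interlacement: given an Euler system $C$, two vertices $v\neq w$ are interlaced with respect to $C$ if they appear in the order $v\ldots w\ldots v\ldots w$ on one of the circuits of $C$. The interlacement matrix $\mathcal{I}(C)$ is the $V(F)\times V(F)$ zero-diagonal symmetric matrix over $GF(2)$ whose $vw$ entry ($v\neq w$) is $1$ if and only if $v$ and $w$ are interlaced with respect to $C$. Transition labels with respect to $C$: at a vertex $v$, orient the circuit of $C$ incident at $v$ (either way). The transition followed by $C$ at $v$ is labeled $\phi$; the other transition in which in-directed half-edges are paired with out-directed half-edges is labeled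 $\chi$; the transition in which the two in-directed half-edges are paired with each other and the two out-directed half-edges are paired with each other is labeled $\psi$. Relative interlacement matrix: for a circuit partition $P$ (for instance an Euler system) and an Euler system $C$ of $F$, $\mathcal{I}_P(C)$ is obtained from $\mathcal{I}(C)$ as follows, all labels being with respect to $C$. If $P$ involves the $\phi$ transition at $v$, change every nonzero entry of the row and column corresponding to $v$ to $0$, and change the diagonal entry of $v$ from $0$ to $1$. If $P$ involves the $\psi$ transition at $v$, change the diagonal entry of $v$ from $0$ to $1$. (No change on account of vertices where $P$ involves the $\chi$ transition.) *)

theory Defs
  imports "HOL-Analysis.Finite_Cartesian_Product" "HOL-Library.Z2"
begin

text \<open>
  A multigraph is given by its half-edges: \<open>vert F h\<close> is the vertex at which the half-edge \<open>h\<close>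
  is incident, and \<open>opp F h\<close> is the other half of the edge containing \<open>h\<close>. The vertices and the
  half-edges are all the elements of the types \<open>'v\<close> and \<open>'h\<close>. An edge \<open>{h, opp F h}\<close> is a loop
  if \<open>vert F h = vert F (opp F h)\<close>, and then has two half-edges at that vertex.
\<close>

record ('v, 'h) multigraph =
  vert :: "'h \<Rightarrow> 'v"
  opp :: "'h \<Rightarrow> 'h"

definition is_multigraph :: "('v::finite, 'h::finite) multigraph \<Rightarrow> bool" where
  "is_multigraph F \<longleftrightarrow> (\<forall>h. opp F h \<noteq> h \<and> opp F (opp F h) = h)"

definition edge_of :: "('v, 'h) multigraph \<Rightarrow> 'h \<Rightarrow> 'h set" where
  "edge_of F h = {h, opp F h}"

definition half_edges_at :: "('v, 'h) multigraph \<Rightarrow> 'v \<Rightarrow> 'h set" where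
  "half_edges_at F v = {h. vert F h = v}"

definition four_regular :: "('v::finite, 'h::finite) multigraph \<Rightarrow> bool" where
  "four_regular F \<longleftrightarrow> is_multigraph F \<and> (\<forall>v. card (half_edges_at F v) = 4)"

definition connected_components :: "('v, 'h) multigraph \<Rightarrow> 'v set set" where
  "connected_components F = UNIV // {(vert F h, vert F (opp F h)) | h. True}\<^sup>*"

definition is_transition :: "('v, 'h) multigraph \<Rightarrow> 'v \<Rightarrow> 'h set set \<Rightarrow> bool" where
  "is_transition F v t \<longleftrightarrow>
     (\<exists>p q. t = {p, q} \<and> card p = 2 \<and> card q = 2 \<and> p \<inter> q = {} \<and> p \<union> q = half_edges_at F v)"

text \<open>
  A closed walk is the list of the half-edges along which it leaves its successive vertices:
  the \<open>i\<close>-th edge is traversed from \<open>hs ! i\<close> to \<open>opp F (hs ! i)\<close>.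
\<close>

definition closed_walk :: "('v, 'h) multigraph \<Rightarrow> 'h list \<Rightarrow> bool" where
  "closed_walk F hs \<longleftrightarrow> hs \<noteq> [] \<and>
     (\<forall>i<length hs. vert F (opp F (hs ! i)) = vert F (hs ! (Suc i mod length hs)))"

definition circuit_walk :: "('v, 'h) multigraph \<Rightarrow> 'h list \<Rightarrow> bool" where
  "circuit_walk F hs \<longleftrightarrow> closed_walk F hs \<and> distinct (map (edge_of F) hs)"

text \<open>The circuit of \<open>hs\<close>: all the closed walks that differ from \<open>hs\<close> in starting point and orientation.\<close>

definition circuit_of :: "('v, 'h) multigraph \<Rightarrow> 'h list \<Rightarrow> 'h list set" where
  "circuit_of F hs = {rotate n hs | n. True} \<union> {rotate n (rev (map (opp F) hs)) | n. True}"

definition follows :: "('v, 'h) multigraph \<Rightarrow> ('v \<Rightarrow> 'h set set) \<Rightarrow> 'h list \<Rightarrow> bool" where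
  "follows F P hs \<longleftrightarrow> (\<forall>i<length hs.
     {opp F (hs ! i), hs ! (Suc i mod length hs)} \<in> P (vert F (hs ! (Suc i mod length hs))))"

text \<open>
  A circuit partition is represented by the transition it involves at each vertex; these
  determine its circuits.
\<close>

definition circuit_partition :: "('v, 'h) multigraph \<Rightarrow> ('v \<Rightarrow> 'h set set) \<Rightarrow> bool" where
  "circuit_partition F P \<longleftrightarrow> (\<forall>v. is_transition F v (P v))"

definition circuits :: "('v, 'h) multigraph \<Rightarrow> ('v \<Rightarrow> 'h set set) \<Rightarrow> 'h list set set" where
  "circuits F P = circuit_of F ` {hs. circuit_walk F hs \<and> follows F P hs}"

definition circuit_verts :: "('v, 'h) multigraph \<Rightarrow> 'h list set \<Rightarrow> 'v set" where
  "circuit_verts F c = (\<Union>hs\<in>c. vert F ` set hs)"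

definition euler_system :: "('v, 'h) multigraph \<Rightarrow> ('v \<Rightarrow> 'h set set) \<Rightarrow> bool" where
  "euler_system F C \<longleftrightarrow> circuit_partition F C \<and>
     (\<forall>K\<in>connected_components F. \<exists>!c. c \<in> circuits F C \<and> circuit_verts F c \<subseteq> K)"

definition compatible :: "('v \<Rightarrow> 'h set set) \<Rightarrow> ('v \<Rightarrow> 'h set set) \<Rightarrow> bool" where
  "compatible P Q \<longleftrightarrow> (\<forall>v. P v \<noteq> Q v)"

definition interlaced :: "('v, 'h) multigraph \<Rightarrow> ('v \<Rightarrow> 'h set set) \<Rightarrow> 'v \<Rightarrow> 'v \<Rightarrow> bool" where
  "interlaced F C v w \<longleftrightarrow> v \<noteq> w \<and>
     (\<exists>c\<in>circuits F C. \<exists>hs\<in>c. \<exists>i j k l. i < j \<and> j < k \<and> k < l \<and> l < length hs \<and>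
        vert F (hs ! i) = v \<and> vert F (hs ! j) = w \<and> vert F (hs ! k) = v \<and> vert F (hs ! l) = w)"

definition interlacement_matrix ::
    "('v::finite, 'h) multigraph \<Rightarrow> ('v \<Rightarrow> 'h set set) \<Rightarrow> bit ^ 'v ^ 'v" where
  "interlacement_matrix F C = (\<chi> v w. if interlaced F C v w then 1 else 0)"

definition out_half_edges :: "('v, 'h) multigraph \<Rightarrow> 'h list \<Rightarrow> 'v \<Rightarrow> 'h set" where
  "out_half_edges F hs v = {h \<in> set hs. vert F h = v}"

definition in_half_edges :: "('v, 'h) multigraph \<Rightarrow> 'h list \<Rightarrow> 'v \<Rightarrow> 'h set" where
  "in_half_edges F hs v = {h \<in> opp F ` set hs. vert F h = v}"

text \<open>
  \<open>labeled_phi F C v t\<close>, \<open>labeled_chi F C v t\<close> and \<open>labeled_psi F C v t\<close> say that the transition \<open>t\<close>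
  at \<open>v\<close> has the label \<open>\<phi>\<close>, \<open>\<chi>\<close> or \<open>\<psi>\<close> with respect to the Euler system \<open>C\<close>. The list \<open>hs\<close> is the
  circuit of \<open>C\<close> incident at \<open>v\<close> with one of its two orientations; the labels do not depend on which.
\<close>

definition labeled_phi ::
    "('v, 'h) multigraph \<Rightarrow> ('v \<Rightarrow> 'h set set) \<Rightarrow> 'v \<Rightarrow> 'h set set \<Rightarrow> bool" where
  "labeled_phi F C v t \<longleftrightarrow> t = C v"

definition labeled_chi ::
    "('v, 'h) multigraph \<Rightarrow> ('v \<Rightarrow> 'h set set) \<Rightarrow> 'v \<Rightarrow> 'h set set \<Rightarrow> bool" where
  "labeled_chi F C v t \<longleftrightarrow> is_transition F v t \<and> t \<noteq> C v \<and>
     (\<exists>c\<in>circuits F C. v \<in> circuit_verts F c \<and>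
        (\<exists>hs\<in>c. \<forall>p\<in>t. \<exists>a\<in>in_half_edges F hs v. \<exists>b\<in>out_half_edges F hs v. p = {a, b}))"

definition labeled_psi ::
    "('v, 'h) multigraph \<Rightarrow> ('v \<Rightarrow> 'h set set) \<Rightarrow> 'v \<Rightarrow> 'h set set \<Rightarrow> bool" where
  "labeled_psi F C v t \<longleftrightarrow> is_transition F v t \<and>
     (\<exists>c\<in>circuits F C. v \<in> circuit_verts F c \<and>
        (\<exists>hs\<in>c. t = {in_half_edges F hs v, out_half_edges F hs v}))"

text \<open>The matrix \<open>\<I>\<^sub>P(C)\<close>, in which \<open>P\<close> is a circuit partition and \<open>C\<close> an Euler system.\<close>

definition rel_interlacement_matrix ::
    "('v::finite, 'h) multigraph \<Rightarrow> ('v \<Rightarrow> 'h set set) \<Rightarrow> ('v \<Rightarrow> 'h set set) \<Rightarrow> bit ^ 'v ^ 'v" where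
  "rel_interlacement_matrix F P C = (\<chi> v w.
     if v = w then
       (if labeled_phi F C v (P v) \<or> labeled_psi F C v (P v) then 1
        else interlacement_matrix F C $ v $ w)
     else if labeled_phi F C v (P v) \<or> labeled_phi F C w (P w) then 0
     else interlacement_matrix F C $ v $ w)"

end

theory Submission imports Defs begin

text \<open>
  Let \<open>L\<close> be the cycle space of \<open>F\<close> over \<open>GF(2)\<close>, that is, the space of edge sets that have even
  degree at every vertex. Let \<open>f\<close> be in \<open>L\<close> and \<open>t\<close> a transition at \<open>v\<close>. The two pairs of \<open>t\<close> contain
  equally many half-edges of \<open>f\<close> modulo 2; this common parity is the value \<open>pairing f t\<close>.

  Let \<open>C\<close> be an Euler system. If \<open>f\<close> has value 0 on all the transitions of \<open>C\<close>, then \<open>f\<close> is constant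
  along the circuits of \<open>C\<close>, hence on every component, and so it has value 0 on every transition
  (\<open>euler_pairing_zero\<close>). For each vertex \<open>v\<close>, the arc \<open>b\<^sub>v\<close> of the circuit of \<open>C\<close> between the two
  visits to \<open>v\<close> is a cycle whose value on \<open>C w\<close> is 1 for \<open>w = v\<close> and 0 otherwise. On a transition
  at \<open>w \<noteq> v\<close> other than \<open>C w\<close>, its value is 1 exactly when \<open>v\<close> and \<open>w\<close> are interlaced, because
  these are the vertices which the arc passes once; at \<open>v\<close> itself, it has value 0 on the
  transition \<open>\<chi>\<close> and 1 on the transition \<open>\<psi>\<close>. So if \<open>P\<close> is compatible with \<open>C\<close>, the entries of
  \<open>\<I>\<^sub>P(C)\<close> are the values of \<open>b\<^sub>v\<close> on \<open>P w\<close> (\<open>euler_basis\<close>).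

  Thus \<open>L\<close>, modulo the cycles on which every pairing vanishes, has the basis \<open>(b\<^sub>v)\<close>, dual to the
  transitions of \<open>C\<close>, and every cycle \<open>f\<close> satisfies, for \<open>P\<close> compatible with \<open>C\<close>,
  \<open>pairing f (P u) = (\<Sum>w. pairing f (C w) * \<I>\<^sub>P(C) $ w $ u)\<close> (\<open>rel_interlacement_product\<close>): the matrix
  \<open>\<I>\<^sub>P(C)\<close> turns the values of \<open>f\<close> on \<open>C\<close> into its values on \<open>P\<close>. In the product of the theorem,
  the values of the basis dual to \<open>C'\<close> are carried from \<open>C\<close> to \<open>C''\<close> and then back to \<open>C'\<close>, where
  they form the identity matrix.
\<close>

section \<open>Transitions\<close>

lemma transition_card: "is_transition F v t \<Longrightarrow> p \<in> t \<Longrightarrow> card p = 2"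
  unfolding is_transition_def by auto

lemma transition_Union: "is_transition F v t \<Longrightarrow> \<Union>t = half_edges_at F v"
  unfolding is_transition_def by auto

lemma transition_elemD:
  assumes "is_transition F v t" "{a, b} \<in> t"
  shows "a \<noteq> b" "vert F a = v" "vert F b = v"
proof -
  show "a \<noteq> b" using transition_card[OF assms] by auto
  have "{a, b} \<subseteq> half_edges_at F v" using transition_Union[OF assms(1)] assms(2) by blast
  then show "vert F a = v" "vert F b = v" by (auto simp: half_edges_at_def)
qed

lemma transition_pair_exists:
  assumes "is_transition F v t" "vert F h = v"
  shows "\<exists>k. {h, k} \<in> t"
proof -
  have "h \<in> \<Union>t" using transition_Union[OF assms(1)] assms(2) by (simp add: half_edges_at_def)
  then obtain p where p: "p \<in> t" "h \<in> p" by blast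
  obtain a b where "p = {a, b}"
    using transition_card[OF assms(1) p(1)] by (auto simp: card_2_iff)
  then have "p = {h, a} \<or> p = {h, b}" using p(2) by auto
  then show ?thesis using p(1) by auto
qed

lemma transition_disjoint:
  assumes "is_transition F v t" "p \<in> t" "q \<in> t" "x \<in> p" "x \<in> q"
  shows "p = q"
  using assms unfolding is_transition_def by auto

lemma transition_pair_unique:
  assumes "is_transition F v t" "{h, k} \<in> t" "{h, l} \<in> t"
  shows "k = l"
  using transition_disjoint[OF assms, of h] by (auto simp: doubleton_eq_iff)

lemma transition_two:
  assumes "is_transition F v t" "p \<in> t" "q \<in> t" "p \<noteq> q"
  shows "t = {p, q}" "p \<inter> q = {}" "p \<union> q = half_edges_at F v"
  using assms unfolding is_transition_def by auto

lemma transition_other: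
  assumes "is_transition F v t" "p \<in> t"
  obtains q where "q \<in> t" "q \<noteq> p"
proof -
  obtain a b where t: "t = {a, b}" "card a = 2" "a \<inter> b = {}"
    using assms(1) unfolding is_transition_def by blast
  then have "a \<noteq> b" by auto
  then show ?thesis using that t(1) assms(2) by blast
qed

text \<open>
  Two distinct transitions at a vertex cross: each pair of one of them takes one half-edge from
  each pair of the other.
\<close>

lemma transition_cross:
  assumes "is_transition F v s" "is_transition F v t" "s \<noteq> t" "p \<in> t"
    "q \<in> s" "q' \<in> s" "q \<noteq> q'"
  obtains x y where "p = {x, y}" "x \<in> q" "y \<in> q'" "x \<noteq> y"
proof -
  obtain u w where p: "p = {u, w}" "u \<noteq> w"
    using transition_card[OF assms(2,4)] by (auto simp: card_2_iff)
  obtain p' where p': "p' \<in> t" "p' \<noteq> p" using transition_other[OF assms(2,4)] .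
  note s = transition_two[OF assms(1,5-7)] and t = transition_two[OF assms(2) p'(1) assms(4) p'(2)]
  have "t = {p, half_edges_at F v - p}" "s = {q, half_edges_at F v - q}"
    "s = {q', half_edges_at F v - q'}"
    using s t by blast+
  then have "p \<noteq> q" "p \<noteq> q'" using assms(3) by metis+
  moreover have "card p = 2" "card q = 2" "card q' = 2"
    using transition_card assms by metis+
  ultimately have "\<not> p \<subseteq> q" "\<not> p \<subseteq> q'"
    by (metis card_subset_eq card.infinite zero_neq_numeral)+
  moreover have "u \<in> q \<union> q'" "w \<in> q \<union> q'" using s t p by blast+
  ultimately consider "u \<in> q" "w \<in> q'" | "w \<in> q" "u \<in> q'" using p(1) by blast
  then show ?thesis
    by cases (use that[of u w] that[of w u] p in \<open>auto simp: insert_commute\<close>)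
qed

section \<open>Cycles and their values on transitions\<close>

text \<open>
  An element of the cycle space over \<open>GF(2)\<close>, given as a function on the half-edges that takes the
  same value on both halves of an edge. A loop is counted twice at its vertex.
\<close>

definition cycle :: "('v, 'h) multigraph \<Rightarrow> ('h \<Rightarrow> bit) \<Rightarrow> bool" where
  "cycle F f \<longleftrightarrow> (\<forall>h. f (opp F h) = f h) \<and> (\<forall>v. (\<Sum>h\<in>half_edges_at F v. f h) = 0)"

text \<open>
  The value of \<open>f\<close> on a transition: the sum of \<open>f\<close> over one of its two pairs. For a cycle the choice
  of the pair does not matter. Choosing it from \<open>t\<close> alone makes the value linear in \<open>f\<close>.
\<close>

definition pairing :: "('h \<Rightarrow> bit) \<Rightarrow> 'h set set \<Rightarrow> bit" where
  "pairing f t = (\<Sum>h\<in>(SOME p. p \<in> t). f h)"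

lemma transition_sum:
  assumes "is_transition F v t" "p \<in> t" "q \<in> t" "p \<noteq> q"
  shows "(\<Sum>h\<in>half_edges_at F v. f h) = (\<Sum>h\<in>p. f h) + (\<Sum>h\<in>q. (f h :: bit))"
proof -
  have "finite p" "finite q" using transition_card assms(1-3) card.infinite by fastforce+
  then show ?thesis
    using sum.union_disjoint[of p q f] transition_two[OF assms] by simp
qed

lemma bit_add_eq_0_iff: "a + b = 0 \<longleftrightarrow> a = (b :: bit)"
  by (cases a; cases b) auto

lemma pairing_eq:
  assumes "cycle F f" "is_transition F v t" "p \<in> t"
  shows "pairing f t = (\<Sum>h\<in>p. f h)"
proof -
  let ?q = "SOME p. p \<in> t"
  have q: "?q \<in> t" using assms(3) by (rule someI)
  show ?thesis
  proof (cases "?q = p")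
    case False
    show ?thesis
      using transition_sum[OF assms(2) q assms(3) False, of f] assms(1)
      unfolding cycle_def pairing_def by (metis bit_add_eq_0_iff)
  qed (simp add: pairing_def)
qed

lemma pairing_pair:
  assumes "cycle F f" "is_transition F v t" "{a, b} \<in> t"
  shows "pairing f t = f a + f b"
  using pairing_eq[OF assms] transition_elemD[OF assms(2,3)] by simp

lemma cycle_combination:
  assumes "\<And>i. i \<in> I \<Longrightarrow> cycle F (g i)" "cycle F f"
  shows "cycle F (\<lambda>h. f h - (\<Sum>i\<in>I. c i * g i h))"
proof -
  have "(\<Sum>h\<in>half_edges_at F v. \<Sum>i\<in>I. c i * g i h)
      = (\<Sum>i\<in>I. c i * (\<Sum>h\<in>half_edges_at F v. g i h))" for v
    unfolding sum_distrib_left by (rule sum.swap)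
  also have "\<dots> v = 0" for v
    using assms(1) unfolding cycle_def by (intro sum.neutral) (metis mult_zero_right)
  finally have "(\<Sum>h\<in>half_edges_at F v. \<Sum>i\<in>I. c i * g i h) = 0" for v .
  moreover have "(\<Sum>i\<in>I. c i * g i (opp F h)) = (\<Sum>i\<in>I. c i * g i h)" for h
    using assms(1) unfolding cycle_def by (intro sum.cong) auto
  ultimately show ?thesis using assms(2) unfolding cycle_def sum_subtractf by simp
qed

lemma pairing_combination:
  "pairing (\<lambda>h. f h - (\<Sum>i\<in>I. c i * g i h)) t = pairing f t - (\<Sum>i\<in>I. c i * pairing (g i) t)"
  unfolding pairing_def sum_subtractf sum_distrib_left
  by (subst sum.swap) (rule refl)

section \<open>Tours\<close>

text \<open>A closed walk that represents a circuit of \<open>C\<close>, with a starting point and an orientation.\<close>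

definition tour :: "('v, 'h) multigraph \<Rightarrow> ('v \<Rightarrow> 'h set set) \<Rightarrow> 'h list \<Rightarrow> bool" where
  "tour F C hs \<longleftrightarrow> circuit_walk F hs \<and> follows F C hs"

lemma tour_nonempty: "tour F C hs \<Longrightarrow> hs \<noteq> []"
  by (simp add: tour_def circuit_walk_def closed_walk_def)

text \<open>The cyclic predecessor of \<open>i\<close> among \<open>0, \<dots>, n - 1\<close>.\<close>

definition prev :: "nat \<Rightarrow> nat \<Rightarrow> nat" where
  "prev n i = (if i = 0 then n - 1 else i - 1)"

lemma prev_less: "i < n \<Longrightarrow> prev n i < n" and
  Suc_prev: "i < n \<Longrightarrow> Suc (prev n i) mod n = i" and
  prev_Suc: "i < n \<Longrightarrow> prev n (Suc i mod n) = i"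
  by (auto simp: prev_def mod_Suc)

text \<open>
  The two half-edges by which the walk enters and leaves its \<open>i\<close>-th vertex; indices are cyclic.
\<close>

definition visit :: "('v, 'h) multigraph \<Rightarrow> 'h list \<Rightarrow> nat \<Rightarrow> 'h set" where
  "visit F hs i = {opp F (hs ! prev (length hs) i), hs ! i}"

context
  fixes F :: "('v::finite, 'h::finite) multigraph" and C :: "'v \<Rightarrow> 'h set set"
  assumes graph: "is_multigraph F" and partition: "circuit_partition F C"
begin

lemma opp_opp [simp]: "opp F (opp F h) = h" and opp_neq [simp]: "opp F h \<noteq> h" "h \<noteq> opp F h"
  using graph unfolding is_multigraph_def by metis+

lemma transition_at: "is_transition F v (C v)"
  using partition unfolding circuit_partition_def by blast

lemma tour_rotate:
  assumes "tour F C hs"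
  shows "tour F C (rotate m hs)"
proof -
  have *: "(m + Suc i mod length hs) mod length hs = Suc ((m + i) mod length hs) mod length hs" for i
    by (simp add: mod_simps)
  have "distinct (map (edge_of F) (rotate m hs))"
    using assms by (simp add: tour_def circuit_walk_def flip: rotate_map)
  moreover have "hs \<noteq> []" using assms by (simp add: tour_def circuit_walk_def closed_walk_def)
  ultimately show ?thesis
    using assms unfolding tour_def circuit_walk_def closed_walk_def follows_def
    by (auto simp: nth_rotate *)
qed

lemma tour_reverse:
  assumes "tour F C hs"
  shows "tour F C (rev (map (opp F) hs))"
proof -
  let ?n = "length hs"
  have ne: "?n > 0" using assms by (simp add: tour_def circuit_walk_def closed_walk_def)
  have edge_opp: "edge_of F \<circ> opp F = edge_of F" by (auto simp: edge_of_def fun_eq_iff)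
  have nth: "rev (map (opp F) hs) ! i = opp F (hs ! (?n - Suc i))" if "i < ?n" for i
    using that by (simp add: rev_nth)
  have step: "\<exists>j<?n. ?n - Suc i = Suc j mod ?n \<and> ?n - Suc (Suc i mod ?n) = j" if "i < ?n" for i
    using that by (intro exI[of _ "?n - Suc (Suc i mod ?n)"]) (auto simp: mod_Suc)
  have "vert F (hs ! (?n - Suc i)) = vert F (opp F (hs ! (?n - Suc (Suc i mod ?n))))
    \<and> {hs ! (?n - Suc i), opp F (hs ! (?n - Suc (Suc i mod ?n)))}
       \<in> C (vert F (opp F (hs ! (?n - Suc (Suc i mod ?n)))))" if i: "i < ?n" for i
  proof -
    obtain j where "j < ?n" "?n - Suc i = Suc j mod ?n" "?n - Suc (Suc i mod ?n) = j"
      using step[OF i] by blast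
    then show ?thesis using assms
      by (simp add: tour_def circuit_walk_def closed_walk_def follows_def insert_commute)
  qed
  then show ?thesis
    using assms ne unfolding tour_def circuit_walk_def closed_walk_def follows_def
    by (auto simp: nth edge_opp simp flip: rev_map)
qed

lemma circuits_tour:
  assumes "c \<in> circuits F C" "hs \<in> c"
  shows "tour F C hs"
  using assms tour_rotate tour_reverse unfolding circuits_def circuit_of_def tour_def by blast

lemma tour_circuit:
  assumes "tour F C hs"
  shows "circuit_of F hs \<in> circuits F C" "hs \<in> circuit_of F hs"
proof -
  show "circuit_of F hs \<in> circuits F C" using assms by (auto simp: circuits_def tour_def)
  have "hs = rotate 0 hs" by simp
  then show "hs \<in> circuit_of F hs" unfolding circuit_of_def by blast
qed

lemma tour_distinct:
  assumes "tour F C hs" "i < length hs" "j < length hs"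
  shows "hs ! i = hs ! j \<longleftrightarrow> i = j" "hs ! i \<noteq> opp F (hs ! j)" "opp F (hs ! i) \<noteq> hs ! j"
proof -
  have d: "edge_of F (hs ! i) = edge_of F (hs ! j) \<longleftrightarrow> i = j"
    using assms nth_eq_iff_index_eq[of "map (edge_of F) hs" i j]
    by (simp add: tour_def circuit_walk_def)
  show "hs ! i = hs ! j \<longleftrightarrow> i = j" using d by metis
  show "hs ! i \<noteq> opp F (hs ! j)" "opp F (hs ! i) \<noteq> hs ! j"
    using d by (auto simp: edge_of_def) (metis opp_opp)+
qed

lemma visit_in:
  assumes "tour F C hs" "i < length hs"
  shows "visit F hs i \<in> C (vert F (hs ! i))"
proof -
  let ?j = "prev (length hs) i"
  have "?j < length hs" "Suc ?j mod length hs = i" using prev_less Suc_prev assms(2) by auto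
  then show ?thesis using assms unfolding tour_def follows_def visit_def by metis
qed

lemma visit_inj:
  assumes "tour F C hs" "i < length hs" "j < length hs" "visit F hs i = visit F hs j"
  shows "i = j"
  using assms(4) tour_distinct[OF assms(1)] prev_less assms(2,3)
  unfolding visit_def by (auto simp: doubleton_eq_iff)

lemma visit_exists:
  assumes "tour F C hs" "h \<in> set hs \<union> opp F ` set hs"
  obtains i where "i < length hs" "vert F (hs ! i) = vert F h" "h \<in> visit F hs i"
proof -
  consider (out) i where "i < length hs" "h = hs ! i"
    | (into) i where "i < length hs" "h = opp F (hs ! i)"
    using assms(2) by (auto simp: in_set_conv_nth)
  then show ?thesis
  proof cases
    case out
    then show ?thesis using that by (auto simp: visit_def)
  next
    case into
    let ?j = "Suc i mod length hs"
    have "?j < length hs" using into by (intro mod_less_divisor) auto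
    moreover have "vert F (hs ! ?j) = vert F h"
      using assms(1) into by (simp add: tour_def circuit_walk_def closed_walk_def)
    moreover have "h \<in> visit F hs ?j" using into by (simp add: visit_def prev_Suc)
    ultimately show ?thesis using that by blast
  qed
qed

section \<open>The tour through a half-edge\<close>

text \<open>The half-edge with which \<open>h\<close> is paired by \<open>C\<close>.\<close>

definition partner :: "'h \<Rightarrow> 'h" where
  "partner h = (THE k. {h, k} \<in> C (vert F h))"

lemma partner_in: "{h, partner h} \<in> C (vert F h)"
  unfolding partner_def
  using theI'[of "\<lambda>k. {h, k} \<in> C (vert F h)"] transition_pair_exists[OF transition_at refl]
    transition_pair_unique[OF transition_at] by metis

lemma partner_neq: "partner h \<noteq> h" and vert_partner: "vert F (partner h) = vert F h"
  using transition_elemD[OF transition_at partner_in] by metis+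

lemma partner_partner: "partner (partner h) = h"
  using partner_in[of h] partner_in[of "partner h"] transition_pair_unique[OF transition_at]
  by (metis insert_commute vert_partner)

text \<open>
  The half-edge along which a walk following \<open>C\<close> continues after leaving a vertex along \<open>h\<close>. Its
  orbits are the oriented circuits of \<open>C\<close>.
\<close>

definition next_half_edge :: "'h \<Rightarrow> 'h" where
  "next_half_edge h = partner (opp F h)"

lemma inj_next: "inj next_half_edge"
  by (rule injI) (metis next_half_edge_def opp_opp partner_partner)

text \<open>
  A walk that follows \<open>C\<close> never runs back along an edge. Otherwise, since reversal turns the next
  half-edge into the previous one, the walk would be symmetric under reversal about its middle,
  which is an edge or a vertex; there \<open>opp\<close> or \<open>partner\<close> would have a fixed point. The induction
  shortens the walk by a step at both ends.
\<close>

lemma next_iterate_neq_opp: "(next_half_edge ^^ k) x \<noteq> opp F x"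
proof (induction k arbitrary: x rule: less_induct)
  case (less k)
  show ?case
  proof
    assume eq: "(next_half_edge ^^ k) x = opp F x"
    consider "k = 0" | "k = 1" | m where "k = Suc (Suc m)" by (metis One_nat_def not0_implies_Suc)
    then show False
    proof cases
      case 3
      let ?y = "(next_half_edge ^^ m) (next_half_edge x)"
      have "partner (opp F ?y) = opp F x"
        using eq 3 by (simp add: funpow_swap1 flip: next_half_edge_def)
      then have "?y = opp F (next_half_edge x)"
        unfolding next_half_edge_def by (metis opp_opp partner_partner)
      then show False using less.IH[of m] 3 by simp
    qed (use eq partner_neq in \<open>auto simp: next_half_edge_def\<close>)
  qed
qed

lemma tour_exists:
  obtains hs where "tour F C hs" "hs ! 0 = h"
proof -
  let ?s = next_half_edge
  \<comment> \<open>The tour is the orbit of \<open>h\<close>, and \<open>n\<close> is its length.\<close>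
  define n where "n = (LEAST n. n > 0 \<and> (?s ^^ n) h = h)"
  obtain n0 where "n0 > 0" "(?s ^^ n0) h = h"
    using funpow_inj_finite[OF inj_next, of h] by auto
  then have n: "n > 0" "(?s ^^ n) h = h"
    unfolding n_def using LeastI[of "\<lambda>n. n > 0 \<and> (?s ^^ n) h = h" n0] by auto
  have least: "(?s ^^ m) h \<noteq> h" if "0 < m" "m < n" for m
    using that not_less_Least unfolding n_def by blast
  define hs where "hs = map (\<lambda>i. (?s ^^ i) h) [0..<n]"
  have len: "length hs = n" by (simp add: hs_def)
  have nth: "hs ! i = (?s ^^ i) h" if "i < n" for i using that by (simp add: hs_def)
  have step: "hs ! (Suc i mod n) = partner (opp F (hs ! i))" if "i < n" for i
  proof (cases "Suc i = n")
    case True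
    then show ?thesis using n nth[of 0] nth[of i] by (auto simp: next_half_edge_def)
  next
    case False
    then show ?thesis using that nth by (simp add: next_half_edge_def)
  qed
  have edge_neq: "edge_of F (hs ! i) \<noteq> edge_of F (hs ! j)" if "i < j" "j < n" for i j
  proof
    assume "edge_of F (hs ! i) = edge_of F (hs ! j)"
    then have "hs ! j = hs ! i \<or> hs ! j = opp F (hs ! i)"
      by (auto simp: edge_of_def doubleton_eq_iff)
    moreover have "hs ! j = (?s ^^ (j - i)) (hs ! i)"
      using that nth funpow_add[of "j - i" i ?s] by simp
    moreover have "hs ! j = (?s ^^ i) ((?s ^^ (j - i)) h)"
      using that nth funpow_add[of i "j - i" ?s] by simp
    ultimately have "(?s ^^ i) ((?s ^^ (j - i)) h) = (?s ^^ i) h"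
      using next_iterate_neq_opp that nth by auto
    then have "(?s ^^ (j - i)) h = h" using inj_fn[OF inj_next] by (metis injD)
    then show False using least that by simp
  qed
  have "distinct (map (edge_of F) hs)"
    unfolding distinct_conv_nth using edge_neq by (auto simp: len) (metis linorder_neqE_nat)
  then have "tour F C hs"
    unfolding tour_def circuit_walk_def closed_walk_def follows_def len
    using step n(1) len partner_in by (auto simp: vert_partner)
  moreover have "hs ! 0 = h" using nth n(1) by simp
  ultimately show ?thesis using that by blast
qed

section \<open>Euler systems determine cycles\<close>

lemma circuit_verts_tour:
  assumes "tour F C hs"
  shows "circuit_verts F (circuit_of F hs) \<subseteq> vert F ` set hs"
proof -
  have "vert F (opp F h) \<in> vert F ` set hs" if h: "h \<in> set hs" for h
  proof -
    obtain i where i: "i < length hs" "hs ! i = h" using h unfolding in_set_conv_nth by blast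
    then have "vert F (opp F h) = vert F (hs ! (Suc i mod length hs))"
      using assms by (auto simp: tour_def circuit_walk_def closed_walk_def)
    moreover have "Suc i mod length hs < length hs"
      using i(1) by (intro mod_less_divisor) auto
    ultimately show ?thesis by simp
  qed
  then have "vert F ` opp F ` set hs \<subseteq> vert F ` set hs" by blast
  moreover have "set xs = set hs \<or> set xs = opp F ` set hs" if "xs \<in> circuit_of F hs" for xs
    using that unfolding circuit_of_def by auto
  ultimately have "vert F ` set xs \<subseteq> vert F ` set hs" if "xs \<in> circuit_of F hs" for xs
    using that by (metis order_refl)
  then show ?thesis unfolding circuit_verts_def by (rule UN_least)
qed

lemma tour_verts_connected:
  assumes "tour F C hs" "i < length hs"
  shows "(vert F (hs ! 0), vert F (hs ! i)) \<in> {(vert F h, vert F (opp F h)) | h. True}\<^sup>*"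
  using assms(2)
proof (induction i)
  case (Suc i)
  then have "vert F (hs ! Suc i) = vert F (opp F (hs ! i))"
    using assms(1) by (simp add: tour_def circuit_walk_def closed_walk_def)
  then have "(vert F (hs ! i), vert F (hs ! Suc i)) \<in> {(vert F h, vert F (opp F h)) | h. True}"
    by auto
  then show ?case using Suc by (simp add: rtrancl.rtrancl_into_rtrancl)
qed simp

text \<open>
  Two circuits of an Euler system that start at the same vertex lie in the same component, so they
  agree up to starting point and orientation.
\<close>

lemma euler_tours:
  assumes "euler_system F C" "tour F C hs" "tour F C hs'" "vert F (hs ! 0) = vert F (hs' ! 0)"
  shows "set hs' = set hs \<or> set hs' = opp F ` set hs"
proof -
  let ?R = "{(vert F h, vert F (opp F h)) | h. True}\<^sup>*"
  let ?K = "?R `` {vert F (hs ! 0)}"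
  have K: "?K \<in> connected_components F" unfolding connected_components_def by (simp add: quotientI)
  have sub: "circuit_verts F (circuit_of F xs) \<subseteq> ?K"
    if "tour F C xs" "vert F (xs ! 0) = vert F (hs ! 0)" for xs
  proof -
    have "vert F ` set xs \<subseteq> ?K"
      using tour_verts_connected[OF that(1)] unfolding that(2) by (auto simp: in_set_conv_nth)
    then show ?thesis using circuit_verts_tour[OF that(1)] by blast
  qed
  have "\<exists>!c. c \<in> circuits F C \<and> circuit_verts F c \<subseteq> ?K"
    using assms(1) K unfolding euler_system_def by (rule conjunct2[THEN bspec])
  then obtain c0 where "\<forall>c. c \<in> circuits F C \<and> circuit_verts F c \<subseteq> ?K \<longrightarrow> c = c0"
    by (elim ex1E) blast
  then have "circuit_of F hs = c0" "circuit_of F hs' = c0"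
    using tour_circuit(1) sub assms(2,3,4) by simp_all
  then have "circuit_of F hs = circuit_of F hs'" by simp
  then have "hs' \<in> circuit_of F hs" using tour_circuit(2)[OF assms(3)] by simp
  then show ?thesis unfolding circuit_of_def by auto
qed

lemma euler_covers:
  assumes "euler_system F C" "tour F C hs" "i < length hs" "vert F h = vert F (hs ! i)"
  shows "h \<in> set hs \<union> opp F ` set hs"
proof -
  obtain hs' where hs': "tour F C hs'" "hs' ! 0 = h" using tour_exists .
  have "rotate i hs ! 0 = hs ! i"
    using assms(3) tour_nonempty[OF assms(2)] nth_rotate[of 0 hs i] by simp
  then have "set hs' = set hs \<or> set hs' = opp F ` set hs"
    using euler_tours[OF assms(1) tour_rotate[OF assms(2), of i] hs'(1)] hs'(2) assms(4) by simp
  moreover have "h \<in> set hs'" using hs' tour_nonempty[OF hs'(1)] by (metis length_greater_0_conv nth_mem)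
  ultimately show ?thesis by blast
qed

lemma constant_on_tour:
  assumes "tour F C hs" "\<And>h. f (opp F h) = f h" "\<And>a b v. {a, b} \<in> C v \<Longrightarrow> f a = f b"
    "h \<in> set hs \<union> opp F ` set hs"
  shows "f h = f (hs ! 0)"
proof -
  have "f (hs ! i) = f (hs ! 0)" if "i < length hs" for i
    using that
  proof (induction i)
    case (Suc i)
    then have "{opp F (hs ! i), hs ! Suc i} \<in> C (vert F (hs ! Suc i))"
      using assms(1) unfolding tour_def follows_def by (metis Suc_lessD mod_less)
    then show ?case using Suc assms(2,3) by (metis Suc_lessD)
  qed simp
  then show ?thesis using assms(2,4) by (auto simp: in_set_conv_nth)
qed

text \<open>
  A cycle with value 0 on the transitions of an Euler system is constant along each tour. All the
  half-edges at a vertex are covered by one tour, so the cycle is constant at each vertex.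
\<close>

lemma euler_pairing_zero:
  assumes euler: "euler_system F C" and f: "cycle F f" "\<And>w. pairing f (C w) = 0"
    and t: "is_transition F v t"
  shows "pairing f t = 0"
proof -
  have inv: "f (opp F h) = f h" for h using f(1) by (simp add: cycle_def)
  have pair: "f a = f b" if "{a, b} \<in> C w" for a b w
    using pairing_pair[OF f(1) transition_at that] f(2) by (metis bit_add_eq_0_iff)
  obtain a where a: "vert F a = v" and "\<exists>b. {a, b} \<in> t"
    using t transition_card[OF t] transition_elemD[OF t] unfolding is_transition_def
    by (metis card_2_iff insertI1)
  then obtain b where ab: "{a, b} \<in> t" by blast
  then have b: "vert F b = v" using transition_elemD[OF t] by blast
  obtain hs where hs: "tour F C hs" "hs ! 0 = a" using tour_exists .
  have "b \<in> set hs \<union> opp F ` set hs"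
    using euler_covers[OF euler hs(1), of 0 b] tour_nonempty[OF hs(1)] hs(2) a b by simp
  then have "f b = f a" using constant_on_tour[of hs f b, OF hs(1) inv pair] hs(2) by simp
  then show ?thesis using pairing_pair[OF f(1) t ab] by (metis bit_add_eq_0_iff)
qed

lemma euler_pairing_unique:
  assumes "euler_system F C" "cycle F f" "cycle F g" "\<And>w. pairing f (C w) = pairing g (C w)"
    and "is_transition F v t"
  shows "pairing f t = pairing g t"
proof -
  let ?d = "\<lambda>h. f h - (\<Sum>i\<in>{()}. 1 * g h)"
  have "cycle F ?d" using assms(2,3) by (intro cycle_combination) auto
  moreover have *: "pairing ?d s = pairing f s - pairing g s" for s
    by (subst pairing_combination) simp
  ultimately have "pairing ?d t = 0"
    using euler_pairing_zero[OF assms(1) _ _ assms(5), of ?d] assms(4) by simp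
  then show ?thesis using * by (metis eq_iff_diff_eq_0)
qed

text \<open>
  Expansion of a cycle in a basis \<open>b\<close> dual to the transitions of an Euler system: the difference
  of the two sides has value 0 on these transitions.
\<close>

lemma euler_expansion:
  assumes "euler_system F C" "cycle F f" "\<And>v. cycle F (b v)"
    and "\<And>v w. pairing (b v) (C w) = of_bool (v = w)"
    and "is_transition F v t"
  shows "pairing f t = (\<Sum>w\<in>UNIV. pairing f (C w) * pairing (b w) t)"
proof -
  let ?d = "\<lambda>h. f h - (\<Sum>w\<in>UNIV. pairing f (C w) * b w h)"
  have "cycle F ?d" using assms(2,3) by (intro cycle_combination) auto
  moreover have "pairing ?d (C u) = 0" for u
  proof -
    have "(\<Sum>w\<in>UNIV. pairing f (C w) * pairing (b w) (C u))
        = (\<Sum>w\<in>UNIV. if w = u then pairing f (C w) else 0)"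
      unfolding assms(4) by (intro sum.cong) auto
    also have "\<dots> = pairing f (C u)" by simp
    finally show ?thesis unfolding pairing_combination by (metis diff_self)
  qed
  ultimately have "pairing ?d t = 0" using euler_pairing_zero[OF assms(1) _ _ assms(5)] by blast
  then show ?thesis unfolding pairing_combination by (metis eq_iff_diff_eq_0)
qed

section \<open>Arcs of a tour\<close>

text \<open>
  The indicator function of the edges of \<open>hs\<close> that are traversed between its \<open>a\<close>-th and its \<open>b\<close>-th
  vertex, that is, of those with indices in \<open>{a..<b}\<close>.
\<close>

definition arc :: "'h list \<Rightarrow> nat \<Rightarrow> nat \<Rightarrow> 'h \<Rightarrow> bit" where
  "arc hs a b h = of_bool (\<exists>i. a \<le> i \<and> i < b \<and> (h = hs ! i \<or> h = opp F (hs ! i)))"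

lemma arc_nth:
  assumes "tour F C hs" "i < length hs" "b \<le> length hs"
  shows "arc hs a b (hs ! i) = of_bool (a \<le> i \<and> i < b)"
    "arc hs a b (opp F (hs ! i)) = of_bool (a \<le> i \<and> i < b)"
proof -
  have "j < length hs" if "j < b" for j using that assms(3) by simp
  then have "(\<exists>j. a \<le> j \<and> j < b \<and> (hs ! i = hs ! j \<or> hs ! i = opp F (hs ! j))) \<longleftrightarrow> a \<le> i \<and> i < b"
    "(\<exists>j. a \<le> j \<and> j < b \<and> (opp F (hs ! i) = hs ! j \<or> opp F (hs ! i) = opp F (hs ! j)))
      \<longleftrightarrow> a \<le> i \<and> i < b"
    using tour_distinct[OF assms(1,2)] by (metis opp_opp)+
  then show "arc hs a b (hs ! i) = of_bool (a \<le> i \<and> i < b)"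
    "arc hs a b (opp F (hs ! i)) = of_bool (a \<le> i \<and> i < b)"
    unfolding arc_def by simp_all
qed

lemma arc_support:
  assumes "tour F C hs" "b \<le> length hs" "arc hs a b h \<noteq> 0"
  shows "h \<in> set hs \<union> opp F ` set hs"
proof -
  obtain i where "i < b" "h = hs ! i \<or> h = opp F (hs ! i)"
    using assms(3) unfolding arc_def by auto
  moreover have "hs ! i \<in> set hs" using calculation(1) assms(2) by simp
  ultimately show ?thesis by blast
qed

lemma visit_covers:
  assumes "tour F C hs" "p \<in> C w" "h \<in> p" "h \<in> set hs \<union> opp F ` set hs"
  obtains i where "i < length hs" "vert F (hs ! i) = w" "p = visit F hs i"
proof -
  obtain i where i: "i < length hs" "vert F (hs ! i) = vert F h" "h \<in> visit F hs i"
    using visit_exists[OF assms(1,4)] .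
  have "h \<in> half_edges_at F w" using transition_Union[OF transition_at, of w] assms(2,3) by blast
  then have "vert F h = w" by (simp add: half_edges_at_def)
  then have "p = visit F hs i"
    using transition_disjoint[OF transition_at assms(2) _ assms(3) i(3)] visit_in[OF assms(1) i(1)] i(2)
    by simp
  then show ?thesis using that i \<open>vert F h = w\<close> by simp
qed

context
  fixes hs :: "'h list" and a b :: nat and v :: 'v
  assumes hs: "tour F C hs" and ab: "a < b" "b < length hs"
    and at_v: "vert F (hs ! a) = v" "vert F (hs ! b) = v"
begin

lemma arc_on_visit:
  assumes "i < length hs"
  shows "arc hs a b (hs ! i) = of_bool (a \<le> i \<and> i < b)"
    and "arc hs a b (opp F (hs ! prev (length hs) i)) = of_bool (a < i \<and> i \<le> b)"
proof -
  show "arc hs a b (hs ! i) = of_bool (a \<le> i \<and> i < b)" using arc_nth[OF hs assms] ab by simp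
  have "a \<le> prev (length hs) i \<and> prev (length hs) i < b \<longleftrightarrow> a < i \<and> i \<le> b"
    using ab assms by (auto simp: prev_def)
  then show "arc hs a b (opp F (hs ! prev (length hs) i)) = of_bool (a < i \<and> i \<le> b)"
    using arc_nth(2)[OF hs prev_less[OF assms], of b a] ab by simp
qed

text \<open>The two visits to \<open>v\<close> use distinct pairs of \<open>C v\<close>, hence all of them.\<close>

lemma visits_at_v: "C v = {visit F hs a, visit F hs b}" "visit F hs a \<noteq> visit F hs b"
proof -
  show "visit F hs a \<noteq> visit F hs b" using visit_inj[OF hs, of a b] ab by linarith
  then show "C v = {visit F hs a, visit F hs b}"
    using transition_two(1)[OF transition_at] visit_in[OF hs] ab at_v by (metis order.strict_trans)
qed

lemma arc_sum_pair:
  assumes "p \<in> C w"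
  shows "(\<Sum>h\<in>p. arc hs a b h) = of_bool (w = v)"
proof (cases "\<exists>i<length hs. vert F (hs ! i) = w \<and> p = visit F hs i")
  case True
  then obtain i where i: "i < length hs" "vert F (hs ! i) = w" "p = visit F hs i" by blast
  have "w = v \<longleftrightarrow> i = a \<or> i = b"
  proof
    assume "w = v"
    then show "i = a \<or> i = b" using visits_at_v(1) assms i visit_inj[OF hs i(1)] ab
      by (metis insertE order.strict_trans singletonD)
  qed (use i at_v in auto)
  moreover have "opp F (hs ! prev (length hs) i) \<noteq> hs ! i"
    using tour_distinct(3)[OF hs prev_less[OF i(1)] i(1)] .
  then have "(\<Sum>h\<in>p. arc hs a b h) = of_bool (a < i \<and> i \<le> b) + of_bool (a \<le> i \<and> i < b)"
    unfolding i(3) visit_def using arc_on_visit[OF i(1)] by simp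
  ultimately show ?thesis using ab by (auto simp: of_bool_def)
next
  case False
  then have "arc hs a b h = 0" if "h \<in> p" for h
    using visit_covers[OF hs assms that] arc_support[OF hs, of b a h] ab by (metis order.strict_implies_order)
  moreover have "w \<noteq> v" using False assms visits_at_v(1) ab at_v by (metis insertE order.strict_trans singletonD)
  ultimately show ?thesis by simp
qed

lemma arc_cycle: "cycle F (arc hs a b)"
  unfolding cycle_def
proof (intro conjI allI)
  fix h show "arc hs a b (opp F h) = arc hs a b h" unfolding arc_def by (metis opp_opp)
next
  fix w
  obtain p where p: "p \<in> C w" using transition_at[of w] unfolding is_transition_def by blast
  obtain q where q: "q \<in> C w" "q \<noteq> p" using transition_other[OF transition_at p] .
  have "(\<Sum>h\<in>half_edges_at F w. arc hs a b h) = of_bool (w = v) + of_bool (w = v)"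
    using transition_sum[OF transition_at q(1) p q(2)] arc_sum_pair p q(1) by simp
  then show "(\<Sum>h\<in>half_edges_at F w. arc hs a b h) = 0" by (simp add: of_bool_def)
qed

lemma arc_pairing: "pairing (arc hs a b) (C w) = of_bool (v = w)"
proof -
  obtain p where p: "p \<in> C w" using transition_at[of w] unfolding is_transition_def by blast
  show ?thesis unfolding pairing_eq[OF arc_cycle transition_at p] arc_sum_pair[OF p] by auto
qed

lemma arc_pairing_interlaced:
  assumes "a < j" "j < b" "b < l" "l < length hs" "vert F (hs ! j) = w" "vert F (hs ! l) = w"
    and t: "is_transition F w t" "t \<noteq> C w"
  shows "pairing (arc hs a b) t = 1"
proof -
  obtain p where p: "p \<in> t" using t(1) unfolding is_transition_def by blast
  have "visit F hs j \<noteq> visit F hs l" using visit_inj[OF hs, of j l] assms by auto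
  then obtain x y where xy: "p = {x, y}" "x \<in> visit F hs j" "y \<in> visit F hs l" "x \<noteq> y"
    using transition_cross[OF transition_at t(1) t(2)[symmetric] p, of "visit F hs j" "visit F hs l"]
      visit_in[OF hs, of j] visit_in[OF hs, of l] assms by auto
  have "arc hs a b x = 1" using xy(2) arc_on_visit[of j] assms unfolding visit_def by auto
  moreover have "arc hs a b y = 0" using xy(3) arc_on_visit[of l] assms unfolding visit_def by auto
  ultimately show ?thesis using pairing_pair[OF arc_cycle t(1)] p xy(1) by simp
qed

lemma in_out_half_edges:
  "out_half_edges F hs v = {hs ! a, hs ! b}"
  "in_half_edges F hs v = {opp F (hs ! prev (length hs) a), opp F (hs ! prev (length hs) b)}"
proof -
  let ?n = "length hs"
  have a: "a < ?n" using ab by simp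
  have at: "half_edges_at F v = visit F hs a \<union> visit F hs b"
    using transition_Union[OF transition_at, of v] visits_at_v(1) by auto
  have out: "hs ! i \<in> set hs" "hs ! i \<notin> opp F ` set hs" if "i < ?n" for i
    using that tour_distinct(2)[OF hs that] unfolding image_iff Bex_def in_set_conv_nth by blast+
  have into: "opp F (hs ! prev ?n i) \<in> opp F ` set hs" "opp F (hs ! prev ?n i) \<notin> set hs"
    if "i < ?n" for i
    using prev_less[OF that] tour_distinct(3)[OF hs prev_less[OF that]]
    unfolding image_iff Bex_def in_set_conv_nth by metis+
  have "out_half_edges F hs v = half_edges_at F v \<inter> set hs"
    "in_half_edges F hs v = half_edges_at F v \<inter> opp F ` set hs"
    by (auto simp: out_half_edges_def in_half_edges_def half_edges_at_def)
  then show "out_half_edges F hs v = {hs ! a, hs ! b}"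
    "in_half_edges F hs v = {opp F (hs ! prev ?n a), opp F (hs ! prev ?n b)}"
    using out[OF a] out[OF ab(2)] into[OF a] into[OF ab(2)] unfolding at visit_def by auto
qed

text \<open>
  At \<open>v\<close>, the arc contains exactly one of the two out-directed half-edges, so it has value 1 on the
  transition that pairs them.
\<close>

lemma arc_pairing_psi:
  assumes t: "is_transition F v t" "t \<noteq> C v"
  shows "pairing (arc hs a b) t = 1 \<longleftrightarrow> t = {in_half_edges F hs v, out_half_edges F hs v}"
proof
  have a: "a < length hs" using ab by simp
  let ?out = "{hs ! a, hs ! b}"
  have out: "hs ! a \<noteq> hs ! b" using tour_distinct(1)[OF hs a ab(2)] ab(1) by simp
  {
    assume "t = {in_half_edges F hs v, out_half_edges F hs v}"
    then have "?out \<in> t" unfolding in_out_half_edges by simp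
    then show "pairing (arc hs a b) t = 1"
      using pairing_pair[OF arc_cycle t(1)] arc_on_visit(1)[OF a] arc_on_visit(1)[OF ab(2)] ab by simp
  next
    assume one: "pairing (arc hs a b) t = 1"
    obtain y where y: "{hs ! a, y} \<in> t" using transition_pair_exists[OF t(1) at_v(1)] by blast
    have visits: "visit F hs a \<in> C v" "visit F hs b \<in> C v" using visits_at_v(1) by simp_all
    obtain x' y' where xy: "{hs ! a, y} = {x', y'}" "x' \<in> visit F hs a" "y' \<in> visit F hs b"
      using transition_cross[OF transition_at t(1) t(2)[symmetric] y visits visits_at_v(2)] .
    have "hs ! a \<in> visit F hs a" by (simp add: visit_def)
    then have "hs ! a \<notin> visit F hs b"
      using transition_disjoint[OF transition_at visits] visits_at_v(2) by blast
    then have "y \<in> visit F hs b" using xy by (metis doubleton_eq_iff)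
    moreover have "arc hs a b y = 0"
      using one pairing_pair[OF arc_cycle t(1) y] arc_on_visit(1)[OF a] ab
      by (cases "arc hs a b y") auto
    ultimately have "y = hs ! b"
      using arc_on_visit(2)[OF ab(2)] ab by (auto simp: visit_def)
    then have out_t: "?out \<in> t" using y by simp
    obtain q where q: "q \<in> t" "q \<noteq> ?out" using transition_other[OF t(1) out_t] .
    have "q = half_edges_at F v - ?out" using transition_two[OF t(1) q(1) out_t q(2)] by blast
    also have "\<dots> = in_half_edges F hs v"
      using transition_Union[OF transition_at, of v] visits_at_v(1)
        tour_distinct(3)[OF hs prev_less[OF a]] tour_distinct(3)[OF hs prev_less[OF ab(2)]] a ab(2)
      unfolding in_out_half_edges visit_def by auto
    finally show "t = {in_half_edges F hs v, out_half_edges F hs v}"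
      using transition_two(1)[OF t(1) q(1) out_t q(2)] unfolding in_out_half_edges(1) by simp
  }
qed

text \<open>
  The arc is constant on each pair of \<open>C w\<close>, so value 1 on another transition at \<open>w\<close> means that one
  visit to \<open>w\<close> is inside the arc and the other one outside. The arc is taken to begin at index 0,
  so that the outer visit comes after the arc, as in the order \<open>v, w, v, w\<close>.
\<close>

lemma interlaced_of_arc_pairing:
  assumes euler: "euler_system F C" and "a = 0" "w \<noteq> v"
    and t: "is_transition F w t" "t \<noteq> C w" and one: "pairing (arc hs a b) t = 1"
  shows "interlaced F C v w"
proof -
  obtain p where p: "p \<in> C w" using transition_at[of w] unfolding is_transition_def by blast
  obtain q where q: "q \<in> C w" "q \<noteq> p" using transition_other[OF transition_at p] .
  obtain r where r: "r \<in> t" using t(1) unfolding is_transition_def by blast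
  obtain x' y' where xy': "r = {x', y'}" "x' \<in> p" "y' \<in> q"
    using transition_cross[OF transition_at t(1) t(2)[symmetric] r p q(1) q(2)[symmetric]] by blast
  have "arc hs a b x' + arc hs a b y' = 1"
    using one pairing_pair[OF arc_cycle t(1)] r xy'(1) by simp
  then have "arc hs a b x' = 1 \<and> arc hs a b y' = 0 \<or> arc hs a b x' = 0 \<and> arc hs a b y' = 1"
    by (cases "arc hs a b x'"; cases "arc hs a b y'") auto
  then obtain x y p' q' where x: "x \<in> p'" "p' \<in> C w" "arc hs a b x = 1"
    and y: "y \<in> q'" "q' \<in> C w" "arc hs a b y = 0"
    using xy' p q(1) by blast
  have "x \<in> set hs \<union> opp F ` set hs" using arc_support[OF hs, of b a x] ab x(3) by simp
  then obtain j where j: "j < length hs" "vert F (hs ! j) = w" "p' = visit F hs j"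
    using visit_covers[OF hs x(2,1)] by blast
  have "y \<in> half_edges_at F w" using transition_Union[OF transition_at, of w] y(1,2) by blast
  then have "y \<in> set hs \<union> opp F ` set hs"
    using euler_covers[OF euler hs j(1)] j(2) by (simp add: half_edges_at_def)
  then obtain l where l: "l < length hs" "vert F (hs ! l) = w" "q' = visit F hs l"
    using visit_covers[OF hs y(2,1)] by blast
  have "j \<noteq> a" "j \<noteq> b" "l \<noteq> a" "l \<noteq> b" using at_v j(2) l(2) assms(3) by auto
  moreover have "j \<le> b" using x(1,3) arc_on_visit[OF j(1)] unfolding j(3) visit_def
    by (auto split: if_splits)
  moreover have "\<not> (a < l \<and> l < b)" using y(1,3) arc_on_visit[OF l(1)] unfolding l(3) visit_def
    by auto
  ultimately have "0 < j" "j < b" "b < l" using assms(2) by auto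
  then have "0 < j \<and> j < b \<and> b < l \<and> l < length hs \<and> vert F (hs ! 0) = v \<and>
      vert F (hs ! j) = w \<and> vert F (hs ! b) = v \<and> vert F (hs ! l) = w"
    using l j at_v assms(2) by simp
  then show ?thesis
    using tour_circuit[OF hs] assms(3) unfolding interlaced_def by blast
qed

end

section \<open>Relative interlacement matrices as values of cycles\<close>

lemma euler_tour_twice:
  assumes "euler_system F C"
  obtains hs b where "tour F C hs" "0 < b" "b < length hs" "vert F (hs ! 0) = v" "vert F (hs ! b) = v"
proof -
  obtain p where p: "p \<in> C v" using transition_at[of v] unfolding is_transition_def by blast
  obtain h where h: "h \<in> p" using transition_card[OF transition_at p] by (metis card_2_iff insertI1)
  obtain hs where hs: "tour F C hs" "hs ! 0 = h" using tour_exists .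
  have at_v: "vert F x = v" if "x \<in> q" "q \<in> C v" for x q
    using transition_Union[OF transition_at, of v] that by (auto simp: half_edges_at_def)
  have len: "0 < length hs" using tour_nonempty[OF hs(1)] by simp
  have visit: "visit F hs 0 \<in> C v" using visit_in[OF hs(1) len] hs(2) at_v h p by simp
  obtain q where q: "q \<in> C v" "q \<noteq> visit F hs 0" using transition_other[OF transition_at visit] .
  obtain x where x: "x \<in> q" using transition_card[OF transition_at q(1)] by (metis card_2_iff insertI1)
  have "x \<in> set hs \<union> opp F ` set hs"
    using euler_covers[OF assms hs(1) len] at_v x q(1) h p hs(2) by simp
  then obtain b where b: "b < length hs" "vert F (hs ! b) = v" "q = visit F hs b"
    using visit_covers[OF hs(1) q(1) x] by blast
  then have "0 < b" using q(2) by (cases b) auto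
  then show ?thesis using that[OF hs(1) _ b(1)] b(2) hs(2) at_v h p by simp
qed

text \<open>
  The definitions of the labels and of interlacement allow any representative \<open>hs'\<close> of the circuit.
  The arcs of \<open>hs\<close> and \<open>hs'\<close> at \<open>v\<close> have the same values on \<open>C\<close>, and therefore on \<open>P\<close>, so that one
  fixed tour suffices.
\<close>

lemma rel_interlacement_arc:
  assumes euler: "euler_system F C" and P: "circuit_partition F P" "compatible C P"
    and hs: "tour F C hs" "0 < b" "b < length hs" "vert F (hs ! 0) = v" "vert F (hs ! b) = v"
  shows "rel_interlacement_matrix F P C $ v $ w = pairing (arc hs 0 b) (P w)"
proof -
  have t: "is_transition F u (P u)" "P u \<noteq> C u" for u
    using P(1) P(2)[unfolded compatible_def, rule_format, of u] by (simp_all add: circuit_partition_def)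
  have unique: "pairing (arc hs 0 b) (P w) = pairing (arc hs' i k) (P w)"
    if "tour F C hs'" "i < k" "k < length hs'" "vert F (hs' ! i) = v" "vert F (hs' ! k) = v"
    for hs' i k
    using euler_pairing_unique[OF euler arc_cycle[OF hs] arc_cycle[OF that] _ t(1)]
      arc_pairing[OF hs] arc_pairing[OF that] by simp
  have bit: "(if A then 1 else 0) = x" if "A \<longleftrightarrow> x = 1" for A and x :: bit
    using that by (cases x) auto
  show ?thesis
  proof (cases "w = v")
    case True
    have "labeled_psi F C v (P v) \<longleftrightarrow> pairing (arc hs 0 b) (P v) = 1"
    proof
      assume "labeled_psi F C v (P v)"
      then obtain c hs' where c: "c \<in> circuits F C" "hs' \<in> c"
        "P v = {in_half_edges F hs' v, out_half_edges F hs' v}"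
        unfolding labeled_psi_def by blast
      have hs': "tour F C hs'" using circuits_tour[OF c(1,2)] .
      have "out_half_edges F hs' v \<in> P v" using c(3) by simp
      then have "card (out_half_edges F hs' v) = 2" by (rule transition_card[OF t(1)])
      then obtain x y where xy: "x \<in> out_half_edges F hs' v" "y \<in> out_half_edges F hs' v" "x \<noteq> y"
        by (metis card_2_iff insert_iff)
      obtain i k where "i < length hs'" "k < length hs'" "hs' ! i = x" "hs' ! k = y"
        using xy(1,2) unfolding out_half_edges_def by (auto simp: in_set_conv_nth)
      moreover have "vert F x = v" "vert F y = v" using xy unfolding out_half_edges_def by auto
      ultimately obtain i k where ik: "i < k" "k < length hs'" "vert F (hs' ! i) = v" "vert F (hs' ! k) = v"
        using xy(3) by (metis linorder_neqE_nat)
      show "pairing (arc hs 0 b) (P v) = 1"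
        using unique[OF hs' ik] arc_pairing_psi[OF hs' ik t] c(3) True by simp
    next
      assume "pairing (arc hs 0 b) (P v) = 1"
      then have "P v = {in_half_edges F hs v, out_half_edges F hs v}"
        using arc_pairing_psi[OF hs t] by simp
      moreover have "v \<in> circuit_verts F (circuit_of F hs)"
        using tour_circuit(2)[OF hs(1)] hs(3,5) unfolding circuit_verts_def by force
      ultimately show "labeled_psi F C v (P v)"
        using t(1) tour_circuit[OF hs(1)] unfolding labeled_psi_def by blast
    qed
    then show ?thesis using True t(2) bit
      by (simp add: rel_interlacement_matrix_def interlacement_matrix_def interlaced_def labeled_phi_def)
  next
    case False
    have "interlaced F C v w \<longleftrightarrow> pairing (arc hs 0 b) (P w) = 1"
    proof
      assume "interlaced F C v w"
      then obtain c hs' i j k l where c: "c \<in> circuits F C" "hs' \<in> c"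
        and ijkl: "i < j" "j < k" "k < l" "l < length hs'" "vert F (hs' ! i) = v"
          "vert F (hs' ! j) = w" "vert F (hs' ! k) = v" "vert F (hs' ! l) = w"
        unfolding interlaced_def by blast
      have ik: "i < k" "k < length hs'" using ijkl by auto
      have hs': "tour F C hs'" using circuits_tour[OF c] .
      show "pairing (arc hs 0 b) (P w) = 1"
        using unique[OF hs' ik ijkl(5,7)]
          arc_pairing_interlaced[OF hs' ik ijkl(5,7) ijkl(1-4,6,8) t] by simp
    qed (use interlaced_of_arc_pairing[OF hs euler refl False t] in blast)
    then show ?thesis using False t(2) bit
      by (simp add: rel_interlacement_matrix_def interlacement_matrix_def labeled_phi_def)
  qed
qed

lemma euler_basis:
  assumes "euler_system F C"
  obtains b where "\<And>v. cycle F (b v)" "\<And>v w. pairing (b v) (C w) = of_bool (v = w)"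
    "\<And>P v w. circuit_partition F P \<Longrightarrow> compatible C P \<Longrightarrow>
      rel_interlacement_matrix F P C $ v $ w = pairing (b v) (P w)"
proof -
  have "\<exists>hs k. tour F C hs \<and> 0 < k \<and> k < length hs \<and> vert F (hs ! 0) = v \<and> vert F (hs ! k) = v" for v
    using euler_tour_twice[OF assms, of v] by metis
  then obtain hs k where *: "\<And>v. tour F C (hs v)" "\<And>v. 0 < k v" "\<And>v. k v < length (hs v)"
    "\<And>v. vert F (hs v ! 0) = v" "\<And>v. vert F (hs v ! k v) = v"
    by metis
  show ?thesis
    by (rule that[of "\<lambda>v. arc (hs v) 0 (k v)"])
      (use arc_cycle[OF *] arc_pairing[OF *] rel_interlacement_arc[OF assms _ _ *] in auto)
qed

end

text \<open>
  The matrix \<open>\<I>\<^sub>P(D)\<close> converts the values of a cycle on the Euler system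
  \<open>D\<close> to its values on \<open>P\<close>.
\<close>

lemma rel_interlacement_product:
  fixes F :: "('v::finite, 'h::finite) multigraph"
  assumes "is_multigraph F" "euler_system F D"
    and f: "cycle F f" and P: "circuit_partition F P" "compatible D P"
  shows "(\<Sum>w\<in>UNIV. pairing f (D w) * rel_interlacement_matrix F P D $ w $ u) = pairing f (P u)"
proof -
  have D: "circuit_partition F D" using assms(2) by (simp add: euler_system_def)
  obtain b where *: "\<And>v. cycle F (b v)" "\<And>v w. pairing (b v) (D w) = of_bool (v = w)"
    "\<And>P v w. circuit_partition F P \<Longrightarrow> compatible D P \<Longrightarrow>
      rel_interlacement_matrix F P D $ v $ w = pairing (b v) (P w)"
    using euler_basis[OF assms(1) D assms(2)] by metis
  have "is_transition F u (P u)" using P(1) by (simp add: circuit_partition_def)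
  then show ?thesis
    using euler_expansion[OF assms(1) D assms(2) f *(1,2)] *(3)[OF P] by simp
qed

theorem corollary21:
  fixes F :: "('v::finite, 'h::finite) multigraph"
    and C C' C'' :: "'v \<Rightarrow> 'h set set"
  assumes "four_regular F"
    and "euler_system F C" and "euler_system F C'" and "euler_system F C''"
    and "compatible C C'" and "compatible C C''" and "compatible C' C''"
  shows "rel_interlacement_matrix F C C' ** rel_interlacement_matrix F C'' C **
           rel_interlacement_matrix F C' C'' = mat 1"
proof -
  have graph: "is_multigraph F" using assms(1) by (simp add: four_regular_def)
  have parts: "circuit_partition F C" "circuit_partition F C'" "circuit_partition F C''"
    using assms(2-4) by (simp_all add: euler_system_def)
  have sym: "compatible C' C" "compatible C'' C'"
    using assms(5,7) by (auto simp: compatible_def)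
  obtain b where b: "\<And>v. cycle F (b v)" "\<And>v w. pairing (b v) (C' w) = of_bool (v = w)"
    "\<And>P v w. circuit_partition F P \<Longrightarrow> compatible C' P \<Longrightarrow>
      rel_interlacement_matrix F P C' $ v $ w = pairing (b v) (P w)"
    using euler_basis[OF graph parts(2) assms(3)] by metis
  \<comment> \<open>Row \<open>v\<close> of \<open>\<I>\<^sub>C(C')\<close> consists of the values of \<open>b v\<close> on \<open>C\<close>.\<close>
  have "(rel_interlacement_matrix F C C' ** rel_interlacement_matrix F C'' C) $ v $ u
      = pairing (b v) (C'' u)" for v u
    using rel_interlacement_product[OF graph assms(2) b(1) parts(3) assms(6)]
      b(3)[OF parts(1) sym(1)] by (simp add: matrix_matrix_mult_def)
  then have "(rel_interlacement_matrix F C C' ** rel_interlacement_matrix F C'' C **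
      rel_interlacement_matrix F C' C'') $ v $ u = pairing (b v) (C' u)" for v u
    using rel_interlacement_product[OF graph assms(4) b(1) parts(2) sym(2)]
    by (simp add: matrix_matrix_mult_def)
  then show ?thesis by (simp add: vec_eq_iff mat_def b(2))
qed

end
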